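(* Let $d\ge 2$ and $p=\frac{2(d+1)}{d-1}$. There is no constant $C>0$ with the following property: for all dyadic $N_1\ge N_2\ge 1$, all $c_*$ with $|c_*-N_1|\le 1$, all balls $B_{N_2}\subset\mathbb{R}^d$ of radius $N_2$, and all $\phi\in L^2(\mathbb{R}\times\mathbb{T}^{d-1})$ with $$\operatorname{supp}\widehat{\phi}\subset\{(\xi,n)\in\mathbb{R}\times\mathbb{Z}^{d-1}:\ c_*-1\le|(\xi,n)|\le c_*+1\}\cap B_{N_2},$$ one has $$\|e^{it\Delta}\phi\|_{L^p_{t,x}([0,1]\times\mathbb{R}\times\mathbb{T}^{d-1})}\le C\|\phi\|_{L^2(\mathbb{R}\times\mathbb{T}^{d-1})}.$$ That is, for suitable such $\phi$ (with $N_2$ large) the ratio $\|e^{it\Delta}\phi\|_{L^p([0,1]\times\mathbb{R}\times\mathbb{T}^{d-1})}/\|\phi\|_{L^2}$ is unbounded as $N_2\to\infty$.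
   Context: $\mathbb{T}=\mathbb{R}/2\pi\mathbb{Z}$. For a function on $\mathbb{R}\times\mathbb{T}^{d-1}$, $\widehat{\phi}(\xi,n)$, $(\xi,n)\in\mathbb{R}\times\mathbb{Z}^{d-1}$, is the Fourier transform in the $\mathbb{R}$ variable combined with Fourier coefficients in the $\mathbb{T}^{d-1}$ variables; $|(\xi,n)|$ is the Euclidean norm in $\mathbb{R}^d$, and $B_{N_2}$ is regarded as a subset of $\mathbb{R}^d\supset\mathbb{R}\times\mathbb{Z}^{d-1}$. $e^{it\Delta}$ is the Fourier multiplier $e^{-it|(\xi,n)|^2}$. *)

theory Defs
  imports "HOL-Analysis.Analysis"
begin

text \<open>Frequency space R x Z^(d-1), with d - 1 = CARD('m).  A frequency is a pair (xi, n).
  Physical space R x T^(d-1): points (x, y), y in real^'m taken 2pi-periodically;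
  the torus is represented by the fundamental box [0, 2pi]^(d-1).\<close>

definition freq_norm :: "real \<Rightarrow> int ^ 'm \<Rightarrow> real" where
  "freq_norm \<xi> n = sqrt (\<xi>\<^sup>2 + (\<Sum>i\<in>UNIV. (real_of_int (n $ i))\<^sup>2))"

definition in_ball :: "real \<times> (real ^ 'm) \<Rightarrow> real \<Rightarrow> real \<Rightarrow> int ^ 'm \<Rightarrow> bool" where
  "in_ball c r \<xi> n \<longleftrightarrow>
     (\<xi> - fst c)\<^sup>2 + (\<Sum>i\<in>UNIV. (real_of_int (n $ i) - snd c $ i)\<^sup>2) \<le> r\<^sup>2"

definition dot_int :: "int ^ 'm \<Rightarrow> real ^ 'm \<Rightarrow> real" where
  "dot_int n y = (\<Sum>i\<in>UNIV. real_of_int (n $ i) * y $ i)"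

text \<open>The Fourier-side datum g plays the role of phi-hat.  The function
  e^{it\<Delta>} phi, where phi is the inverse Fourier transform of g
  (normalisation constants are irrelevant for the statement):
  (e^{it\<Delta>}phi)(x,y) = sum_n int g(xi,n) e^{i(x xi + n.y)} e^{-it|(xi,n)|^2} dxi.
  Under the support hypotheses only finitely many n contribute.\<close>

definition schrod :: "(real \<times> (int ^ 'm) \<Rightarrow> complex) \<Rightarrow> real \<Rightarrow> real \<Rightarrow> real ^ 'm \<Rightarrow> complex" where
  "schrod g t x y =
     (\<Sum>n\<in>{n. \<exists>\<xi>. g (\<xi>, n) \<noteq> 0}.
        LINT \<xi>|lborel. g (\<xi>, n) *
          cis (x * \<xi> + dot_int n y - t * (freq_norm \<xi> n)\<^sup>2))"

definition torus_box :: "(real ^ 'm) set" where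
  "torus_box = cbox 0 (\<chi> i. 2 * pi)"

definition enn_root :: "real \<Rightarrow> ennreal \<Rightarrow> ennreal" where
  "enn_root p I = (if I = \<infinity> then \<infinity> else ennreal (enn2real I powr (1 / p)))"

definition L2_norm :: "(real \<Rightarrow> real ^ 'm \<Rightarrow> complex) \<Rightarrow> ennreal" where
  "L2_norm f = enn_root 2
     (\<integral>\<^sup>+ x. (\<integral>\<^sup>+ y. indicator torus_box y * ennreal ((cmod (f x y))\<^sup>2) \<partial>lborel) \<partial>lborel)"

definition Lp_norm_01 :: "real \<Rightarrow> (real \<Rightarrow> real \<Rightarrow> real ^ 'm \<Rightarrow> complex) \<Rightarrow> ennreal" where
  "Lp_norm_01 p u = enn_root p
     (\<integral>\<^sup>+ t. indicator {0..1} t *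
        (\<integral>\<^sup>+ x. (\<integral>\<^sup>+ y. indicator torus_box y * ennreal (cmod (u t x y) powr p) \<partial>lborel)
          \<partial>lborel) \<partial>lborel)"

end

theory Submission
  imports Defs "HOL-Library.Real_Mod" "HOL-Probability.Sinc_Integral"
begin

text \<open>
  Take the datum to be the indicator of [M, M + 1/2] x {0, ..., N - 1}^m with m = d - 1 and M much
  larger than N^2. Near the frequency (M, 0) the annulus is a slab containing this set, and the
  evolution is F(t, x) h(t, y_1) ... h(t, y_m), where \<bar>F\<bar> is bounded below on a unit interval
  around x = 2Mt and h is the Weyl sum of cis (n z - t n^2) over n < N. So the estimate would imply
  the lossless endpoint Strichartz estimate on the torus T^m.

  That estimate fails logarithmically. For t within 1/(2N^2) of 2 pi a/q with q at most N, expanding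
  the square and summing over b < q leaves only the pairs n, n' congruent mod q, whence the sum of
  \<bar>h(t, w + 2 pi b/q)\<bar>^2 over b is at least N^2/4 for small w; convexity turns this into a lower
  bound for the L^p norm without evaluating Gauss sums. Each reduced a/q then contributes a multiple
  of N^(m+2)/q^2 to the p-th power of the L^p norm, and the sum of 1/q^2 over reduced fractions with
  q at most N is at least a multiple of the harmonic number of N, whereas the p-th power of the L^2
  norm is of order N^(m+2).
\<close>

subsection \<open>Weyl sums near rational times\<close>

definition weyl_sum :: "nat \<Rightarrow> real \<Rightarrow> real \<Rightarrow> complex" where
  "weyl_sum N t z = (\<Sum>n<N. cis (real n * z - t * (real n)\<^sup>2))"

text \<open>Orthogonality of the additive characters mod q: a geometric sum in a q-th root of unity
  that equals 1 exactly when \<open>q\<close> divides \<open>k\<close>.\<close>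

lemma sum_cis_roots_of_unity:
  fixes k :: int
  assumes "q > 0"
  shows "(\<Sum>b<q. cis (2 * pi * real b / real q * of_int k)) =
    (if int q dvd k then of_nat q else 0)"
proof -
  define \<zeta> where "\<zeta> = cis (2 * pi * of_int k / real q)"
  have pow: "cis (2 * pi * real b / real q * of_int k) = \<zeta> ^ b" for b
    by (simp add: \<zeta>_def Complex.DeMoivre mult_ac)
  have one: "\<zeta> = 1 \<longleftrightarrow> int q dvd k"
  proof
    assume "\<zeta> = 1"
    then obtain j :: int where "2 * pi * of_int k / real q = of_int j * (2 * pi)"
      unfolding \<zeta>_def cis_eq_1_iff by blast
    then have "real_of_int k = real_of_int (int q * j)"
      using assms by (simp add: field_simps)
    then show "int q dvd k"
      by (metis dvd_triv_left of_int_eq_iff)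
  next
    assume "int q dvd k"
    then obtain j where "k = int q * j" ..
    then show "\<zeta> = 1"
      using assms cis_multiple_2pi[of "of_int j"] by (simp add: \<zeta>_def mult.assoc)
  qed
  have "\<zeta> ^ q = 1"
    using assms by (simp add: \<zeta>_def Complex.DeMoivre)
  then show ?thesis
    unfolding pow one[symmetric] by (auto simp: sum_gp_strict)
qed

text \<open>Each complete block of \<open>q\<close> consecutive numbers below \<open>N\<close>
  contains one member of the class; an incomplete last block is ignored.\<close>

lemma card_residue_class_ge:
  assumes "q > 0"
  shows "N div q \<le> card {n \<in> {..<N}. n mod q = r mod q}"
proof -
  have "(\<lambda>j. r mod q + q * j) ` {..<N div q} \<subseteq> {n \<in> {..<N}. n mod q = r mod q}"
  proof safe
    fix j assume "j < N div q"
    then have "q * Suc j \<le> q * (N div q)"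
      by (intro mult_le_mono2) auto
    also have "\<dots> \<le> N" by simp
    finally show "r mod q + q * j < N"
      using mod_less_divisor[OF assms, of r] by (simp del: mod_less_divisor) 
  qed simp
  then have "card ((\<lambda>j. r mod q + q * j) ` {..<N div q}) \<le> card {n \<in> {..<N}. n mod q = r mod q}"
    by (intro card_mono) auto
  then show ?thesis
    using assms by (simp add: card_image inj_on_def)
qed

lemma cos_ge_half: "\<bar>x\<bar> \<le> 1 \<Longrightarrow> cos x \<ge> 1 / 2" for x :: real
proof -
  assume "\<bar>x\<bar> \<le> 1"
  then have "\<bar>x\<bar> \<le> pi / 3" using pi_gt3 by simp
  then have "cos (pi / 3) \<le> cos \<bar>x\<bar>"
    using pi_gt3 by (intro cos_monotone_0_pi_le) auto
  then show ?thesis by (simp add: cos_60)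
qed

text \<open>On congruent pairs the rational part of the phase drops out and the rest differs by at
  most 1, so each such pair contributes at least q/2. Every residue class has at least N/(2q)
  members, whence N * N/(2q) * q/2 = N^2/4.\<close>

lemma sum_weyl_sum_square_ge:
  assumes q: "0 < q" "q \<le> N"
    and \<tau>: "0 \<le> \<tau>" "\<tau> \<le> 1 / (2 * (real N)\<^sup>2)"
    and w: "0 \<le> w" "w \<le> 1 / (2 * real N)"
  shows "(real N)\<^sup>2 / 4 \<le>
    (\<Sum>b<q. (cmod (weyl_sum N (2 * pi * real a / real q + \<tau>) (w + 2 * pi * real b / real q)))\<^sup>2)"
proof -
  \<comment> \<open>The part of the phase due to \<open>w\<close> and \<tau>. Both of its terms lie
    in [0, 1/2] for n < N, so two values of \<theta> differ by at most 1.\<close>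
  define \<theta> where "\<theta> n = real n * w - \<tau> * (real n)\<^sup>2" for n
  define \<alpha> where "\<alpha> n = \<theta> n - 2 * pi * real a / real q * (real n)\<^sup>2" for n
  let ?h = "\<lambda>b. weyl_sum N (2 * pi * real a / real q + \<tau>) (w + 2 * pi * real b / real q)"
  define R where "R = {(n, n'). n < N \<and> n' < N \<and> n mod q = n' mod q}"
  have N: "N > 0" using q by simp
  have \<theta>: "\<bar>\<theta> n\<bar> \<le> 1 / 2" if "n < N" for n
  proof -
    have "real n * w \<le> real N * (1 / (2 * real N))"
      using that w by (intro mult_mono) auto
    moreover have "\<tau> * (real n)\<^sup>2 \<le> 1 / (2 * (real N)\<^sup>2) * (real N)\<^sup>2"
      using that \<tau> by (intro mult_mono power_mono) auto
    moreover have "0 \<le> real n * w" "0 \<le> \<tau> * (real n)\<^sup>2"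
      using w \<tau> by auto
    ultimately show ?thesis using N unfolding \<theta>_def abs_le_iff by (auto simp: field_simps)
  qed
  \<comment> \<open>The shift by 2 pi b/q enters only through an additive character mod q, which the
    later sum over b exploits.\<close>
  have h: "?h b = (\<Sum>n<N. cis (\<alpha> n) * cis (2 * pi * real b / real q * of_int (int n)))" for b
    unfolding weyl_sum_def by (intro sum.cong) (auto simp: \<alpha>_def \<theta>_def cis_mult algebra_simps)
  have sq: "complex_of_real ((cmod (?h b))\<^sup>2) = (\<Sum>n<N. \<Sum>n'<N. cis (\<alpha> n - \<alpha> n') *
      cis (2 * pi * real b / real q * of_int (int n - int n')))" for b
    unfolding complex_norm_square h cnj_sum sum_product
    by (intro sum.cong) (auto simp: cis_mult cis_cnj algebra_simps diff_divide_distrib)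
  have cong: "int q dvd int n - int n' \<longleftrightarrow> n mod q = n' mod q" for n n'
    by (metis mod_eq_dvd_iff of_nat_eq_iff zmod_int)
  have "complex_of_real (\<Sum>b<q. (cmod (?h b))\<^sup>2) =
      (\<Sum>n<N. \<Sum>n'<N. cis (\<alpha> n - \<alpha> n') *
        (\<Sum>b<q. cis (2 * pi * real b / real q * of_int (int n - int n'))))"
    unfolding of_real_sum sq sum_distrib_left
    by (rule trans[OF sum.swap], rule sum.cong[OF refl], rule sum.swap)
  also have "\<dots> = (\<Sum>n<N. \<Sum>n'<N. if n mod q = n' mod q then of_nat q * cis (\<alpha> n - \<alpha> n') else 0)"
    unfolding sum_cis_roots_of_unity[OF q(1)] cong by (intro sum.cong) auto
  also have "\<dots> = (\<Sum>n<N. \<Sum>n'\<in>{n'\<in>{..<N}. n' mod q = n mod q}. of_nat q * cis (\<alpha> n - \<alpha> n'))"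
    by (subst sum.inter_filter) (auto intro!: sum.cong)
  finally have "(\<Sum>b<q. (cmod (?h b))\<^sup>2) =
      Re (\<Sum>n<N. \<Sum>n'\<in>{n'\<in>{..<N}. n' mod q = n mod q}. of_nat q * cis (\<alpha> n - \<alpha> n'))"
    by (metis Re_complex_of_real)
  also have "\<dots> = (\<Sum>n<N. \<Sum>n'\<in>{n'\<in>{..<N}. n' mod q = n mod q}. real q * cos (\<alpha> n - \<alpha> n'))"
    unfolding Re_sum by (intro sum.cong refl) simp
  finally have "(\<Sum>b<q. (cmod (?h b))\<^sup>2) =
      (\<Sum>n<N. \<Sum>n'\<in>{n'\<in>{..<N}. n' mod q = n mod q}. real q * cos (\<alpha> n - \<alpha> n'))" .
  moreover have "(\<Sum>n<N. \<Sum>n'\<in>{n'\<in>{..<N}. n' mod q = n mod q}. real q * cos (\<alpha> n - \<alpha> n')) \<ge>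
      (\<Sum>n<N. \<Sum>n'\<in>{n'\<in>{..<N}. n' mod q = n mod q}. real q * (1 / 2))"
  proof (intro sum_mono mult_left_mono)
    fix n n' assume n: "n \<in> {..<N}" "n' \<in> {n'\<in>{..<N}. n' mod q = n mod q}"
    \<comment> \<open>As q divides n - n', it divides n^2 - n'^2, and the term with a/q changes the
      phase by a multiple of 2 pi.\<close>
    then have "int q dvd int n - int n'" unfolding cong by simp
    then obtain j where j: "int n - int n' = int q * j" ..
    have "(real n)\<^sup>2 - (real n')\<^sup>2 = of_int ((int n - int n') * (int n + int n'))"
      by (simp add: power2_eq_square algebra_simps)
    also have "\<dots> = real q * of_int (j * (int n + int n'))"
      unfolding j by simp
    finally have "2 * pi * real a / real q * ((real n)\<^sup>2 - (real n')\<^sup>2) =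
        2 * pi * of_int (int a * j * (int n + int n'))"
      using q by (simp add: field_simps)
    then have "\<alpha> n - \<alpha> n' = (\<theta> n - \<theta> n') - 2 * pi * of_int (int a * j * (int n + int n'))"
      unfolding \<alpha>_def by (simp add: algebra_simps)
    then have "cis (\<alpha> n - \<alpha> n') = cis (\<theta> n - \<theta> n')"
      by (metis cis_multiple_2pi Ints_of_int cis_divide div_by_1)
    then have "cos (\<alpha> n - \<alpha> n') = cos (\<theta> n - \<theta> n')"
      by (metis cis.simps(1))
    also have "\<dots> \<ge> 1 / 2"
      using \<theta>[of n] \<theta>[of n'] n by (intro cos_ge_half) auto
    finally show "1 / 2 \<le> cos (\<alpha> n - \<alpha> n')" .
  qed auto
  moreover have "(\<Sum>n<N. \<Sum>n'\<in>{n'\<in>{..<N}. n' mod q = n mod q}. real q * (1 / 2)) \<ge>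
      (\<Sum>n<N. real N / 4)"
  proof (intro sum_mono)
    fix n
    \<comment> \<open>Since q is at most N, the quotient is at least 1, and rounding down loses at
      most a factor 2.\<close>
    have "N < q * Suc (N div q)"
      using q by (metis dividend_less_div_times mult.commute mult_Suc_right add.commute)
    also have "\<dots> \<le> q * (2 * (N div q))"
      using q by (intro mult_le_mono2) (simp add: Suc_leI mult_2 div_greater_zero_iff)
    also have "\<dots> \<le> q * (2 * card {n' \<in> {..<N}. n' mod q = n mod q})"
      using card_residue_class_ge[OF q(1), of N n] by (intro mult_le_mono2) auto
    finally have "real N \<le> real (q * (2 * card {n' \<in> {..<N}. n' mod q = n mod q}))"
      by linarith
    then show "real N / 4 \<le> (\<Sum>n'\<in>{n'\<in>{..<N}. n' mod q = n mod q}. real q * (1 / 2))"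
      by (simp add: algebra_simps)
  qed
  ultimately show ?thesis
    by (simp add: power2_eq_square)
qed

lemma sum_powr_ge_of_sum_ge:
  fixes X :: "'a \<Rightarrow> real"
  assumes "finite S" "r > 1" "L > 0"
    and nonneg: "\<And>i. i \<in> S \<Longrightarrow> 0 \<le> X i"
    and sum: "real (card S) * L \<le> (\<Sum>i\<in>S. X i)"
  shows "real (card S) * L powr r \<le> (\<Sum>i\<in>S. X i powr r)"
proof -
  \<comment> \<open>Young's inequality for X i times L powr (r - 1), summed over i.\<close>
  define s where "s = r / (r - 1)"
  have s: "s > 1" "1 / r + 1 / s = 1" "(r - 1) * s = r"
    using assms(2) by (auto simp: s_def field_simps)
  have pw: "L * L powr (r - 1) = L powr r"
    using assms(3) by (simp add: powr_mult_base)
  have pt: "r * (X i * L powr (r - 1)) \<le> X i powr r + (r - 1) * L powr r" if "i \<in> S" for i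
  proof -
    have "X i * L powr (r - 1) \<le> X i powr r / r + (L powr (r - 1)) powr s / s"
      using assms s nonneg[OF that] by (intro Youngs_inequality) auto
    also have "\<dots> = X i powr r / r + (r - 1) / r * L powr r"
      using s assms(2) by (simp add: powr_powr s_def)
    finally show ?thesis
      using assms(2) by (simp add: field_simps)
  qed
  have "r * (real (card S) * L powr r) = r * ((real (card S) * L) * L powr (r - 1))"
    by (simp add: pw[symmetric] mult_ac)
  also have "\<dots> \<le> r * ((\<Sum>i\<in>S. X i) * L powr (r - 1))"
    using assms by (intro mult_left_mono mult_right_mono) auto
  also have "\<dots> = (\<Sum>i\<in>S. r * (X i * L powr (r - 1)))"
    by (simp add: sum_distrib_left sum_distrib_right)
  also have "\<dots> \<le> (\<Sum>i\<in>S. X i powr r + (r - 1) * L powr r)"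
    by (intro sum_mono pt)
  also have "\<dots> = (\<Sum>i\<in>S. X i powr r) + (r - 1) * (real (card S) * L powr r)"
    by (simp add: sum.distrib)
  finally show ?thesis by (simp add: algebra_simps)
qed

lemma continuous_on_weyl_sum [continuous_intros]:
  "continuous_on S (weyl_sum N t)"
  unfolding weyl_sum_def cis_conv_exp by (intro continuous_intros)

lemma borel_measurable_weyl_sum [measurable]:
  "weyl_sum N t \<in> borel_measurable borel"
  by (intro borel_measurable_continuous_onI continuous_intros)

text \<open>The q windows of width 1/(2N) starting at 2 pi b/q are translated to one common window.
  There the squares sum to at least q * L with L = N^2/(4q), convexity gives q * L^r for the powers,
  and integration adds the factor 1/(2N).\<close>

lemma nn_integral_weyl_sum_powr_ge:
  assumes q: "0 < q" "q \<le> N"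
    and \<tau>: "0 \<le> \<tau>" "\<tau> \<le> 1 / (2 * (real N)\<^sup>2)"
    and r: "r > 1"
  shows "ennreal (real q / (2 * real N) * ((real N)\<^sup>2 / (4 * real q)) powr r) \<le>
    (\<integral>\<^sup>+ z. indicator {0..2 * pi} z *
      ennreal (cmod (weyl_sum N (2 * pi * real a / real q + \<tau>) z) powr (2 * r)) \<partial>lborel)"
proof -
  define L where "L = (real N)\<^sup>2 / (4 * real q)"
  define \<delta> where "\<delta> = 1 / (2 * real N)"
  define z where "z b = 2 * pi * real b / real q" for b
  define f where "f x = ennreal (cmod (weyl_sum N (2 * pi * real a / real q + \<tau>) x) powr (2 * r))" for x
  have f [measurable]: "f \<in> borel_measurable borel"
    unfolding f_def by measurable
  have N: "N > 0" and L: "L > 0" and \<delta>: "\<delta> > 0" using q by (auto simp: L_def \<delta>_def)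
  have "real q < 4 * pi * real N"
  proof -
    have "real q \<le> real N" using q by simp
    also have "\<dots> < 4 * pi * real N" using N pi_gt3 by simp
    finally show ?thesis .
  qed
  \<comment> \<open>The spacing of the windows exceeds their width, which makes them
    disjoint.\<close>
  then have gap: "\<delta> < 2 * pi / real q"
    using q N by (simp add: \<delta>_def field_simps)
  have step: "z b + \<delta> < z b'" if "b < b'" for b b' :: nat
  proof -
    have "z (Suc b) \<le> z b'" 
      using that q unfolding z_def by (intro divide_right_mono mult_left_mono) auto
    moreover have "z b + \<delta> < z (Suc b)"
      using gap by (simp add: z_def algebra_simps add_divide_distrib)
    ultimately show ?thesis by simp
  qed
  have disj: "disjoint_family_on (\<lambda>b. {z b..z b + \<delta>}) {..<q}"
    unfolding disjoint_family_on_def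
  proof (intro ballI impI)
    fix b b' :: nat assume "b \<noteq> b'"
    then consider "b < b'" | "b' < b" by linarith
    then show "{z b..z b + \<delta>} \<inter> {z b'..z b' + \<delta>} = {}"
      using step[of b b'] step[of b' b] by cases auto
  qed
  \<comment> \<open>\<open>z q\<close> is the right end of the period, so the separation from it
    keeps every window with b < q inside.\<close>
  have "z q = 2 * pi" "\<And>b. 0 \<le> z b" using q by (auto simp: z_def)
  then have sub: "(\<Union>b<q. {z b..z b + \<delta>}) \<subseteq> {0..2 * pi}"
    using step[of _ q] by (fastforce intro: order_trans)
  have "ennreal (real q / (2 * real N) * L powr r) = ennreal (real q * L powr r) * emeasure lborel {0..\<delta>}"
    using \<delta> by (simp add: \<delta>_def flip: ennreal_mult')
  also have "\<dots> = (\<integral>\<^sup>+ w. ennreal (real q * L powr r) * indicator {0..\<delta>} w \<partial>lborel)"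
    by (subst nn_integral_cmult_indicator) auto
  also have "\<dots> \<le> (\<integral>\<^sup>+ w. (\<Sum>b<q. indicator {z b..z b + \<delta>} (z b + w) * f (z b + w)) \<partial>lborel)"
  proof (intro nn_integral_mono)
    fix w :: real
    show "ennreal (real q * L powr r) * indicator {0..\<delta>} w \<le>
        (\<Sum>b<q. indicator {z b..z b + \<delta>} (z b + w) * f (z b + w))"
    proof (cases "w \<in> {0..\<delta>}")
      case True
      define X where "X b = (cmod (weyl_sum N (2 * pi * real a / real q + \<tau>) (w + z b)))\<^sup>2" for b
      have X: "f (z b + w) = ennreal (X b powr r)" for b
        unfolding f_def X_def by (simp add: powr_powr add.commute flip: powr_numeral)
      have "real (card {..<q}) * L \<le> (\<Sum>b<q. X b)"
        using sum_weyl_sum_square_ge[OF q \<tau>, of w a] True q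
        unfolding X_def z_def \<delta>_def L_def by simp
      then have "real (card {..<q}) * L powr r \<le> (\<Sum>b<q. X b powr r)"
        using r L by (intro sum_powr_ge_of_sum_ge) (auto simp: X_def)
      then have "ennreal (real q * L powr r) \<le> (\<Sum>b<q. f (z b + w))"
        unfolding X by (simp add: sum_ennreal ennreal_leI)
      then show ?thesis using True by simp
    qed auto
  qed
  also have "\<dots> = (\<Sum>b<q. \<integral>\<^sup>+ w. indicator {z b..z b + \<delta>} (z b + w) * f (z b + w) \<partial>lborel)"
    by (intro nn_integral_sum) measurable
  also have "\<dots> = (\<Sum>b<q. \<integral>\<^sup>+ x. indicator {z b..z b + \<delta>} x * f x \<partial>lborel)"
  proof (intro sum.cong refl)
    fix b
    show "(\<integral>\<^sup>+ w. indicator {z b..z b + \<delta>} (z b + w) * f (z b + w) \<partial>lborel) =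
        (\<integral>\<^sup>+ x. indicator {z b..z b + \<delta>} x * f x \<partial>lborel)"
      using nn_integral_real_affine[of "\<lambda>x. indicator {z b..z b + \<delta>} x * f x" 1 "z b"] by simp
  qed
  also have "\<dots> = (\<integral>\<^sup>+ x. (\<Sum>b<q. indicator {z b..z b + \<delta>} x * f x) \<partial>lborel)"
    by (intro nn_integral_sum[symmetric]) measurable
  also have "\<dots> = (\<integral>\<^sup>+ x. indicator (\<Union>b<q. {z b..z b + \<delta>}) x * f x \<partial>lborel)"
    by (subst indicator_UN_disjoint[OF _ disj]) (simp_all add: sum_distrib_right)
  also have "\<dots> \<le> (\<integral>\<^sup>+ x. indicator {0..2 * pi} x * f x \<partial>lborel)"
    by (intro nn_integral_mono mult_right_mono indicator_leI, erule subsetD[OF sub], simp)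
  finally show ?thesis unfolding L_def f_def .
qed

subsection \<open>Integrals over the torus and the line\<close>

text \<open>Tonelli, with the coordinates read as inner products with the standard basis
  vectors.\<close>

lemma nn_integral_vec_prod:
  fixes f :: "real \<Rightarrow> ennreal"
  assumes [measurable]: "f \<in> borel_measurable borel"
  shows "(\<integral>\<^sup>+ y. (\<Prod>i\<in>UNIV. f (y $ i)) \<partial>(lborel :: (real ^ 'm::finite) measure)) =
    (\<integral>\<^sup>+ z. f z \<partial>lborel) ^ CARD('m)"
proof -
  have B: "(Basis :: (real ^ 'm) set) = (\<lambda>i. axis i 1) ` UNIV"
    by (auto simp: Basis_vec_def)
  have inj: "inj (\<lambda>i. axis i 1 :: real ^ 'm)"
    by (auto simp: inj_def axis_eq_axis)
  have "(\<Prod>i\<in>UNIV. f (y $ i)) = (\<Prod>b\<in>Basis. f (y \<bullet> b))" for y :: "real ^ 'm"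
    unfolding B by (subst prod.reindex[OF inj]) (simp add: inner_axis)
  moreover have "card (Basis :: (real ^ 'm) set) = CARD('m)"
    unfolding B by (rule card_image[OF inj])
  ultimately show ?thesis
    using nn_integral_lborel_prod[where f="\<lambda>_ :: real ^ 'm. f"] by simp
qed

lemma indicator_torus_box:
  "indicator torus_box y = (\<Prod>i\<in>UNIV. indicator {0..2 * pi} (y $ i) :: ennreal)"
  by (auto simp: torus_box_def mem_box_cart split: split_indicator)

lemma set_integral_cis_Icc:
  fixes a b x :: real
  assumes "a \<le> b" "x \<noteq> 0"
  shows "(LINT \<xi>:{a..b}|lborel. cis (x * \<xi>)) = (cis (x * b) - cis (x * a)) / (\<i> * of_real x)"
proof -
  have "(LINT \<xi>|lborel. indicator {a..b} \<xi> *\<^sub>R cis (x * \<xi>)) =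
      cis (x * b) / (\<i> * of_real x) - cis (x * a) / (\<i> * of_real x)"
  proof (rule integral_FTC_atLeastAtMost[OF assms(1)])
    show "((\<lambda>\<xi>. cis (x * \<xi>) / (\<i> * of_real x)) has_vector_derivative cis (x * \<xi>)) (at \<xi> within {a..b})" for \<xi>
      using assms(2) unfolding cis_conv_exp
      by (auto intro!: derivative_eq_intros has_vector_derivative_real_field simp: field_simps)
    show "continuous_on {a..b} (\<lambda>\<xi>. cis (x * \<xi>))"
      unfolding cis_conv_exp by (intro continuous_intros)
  qed
  then show ?thesis
    by (simp add: set_lebesgue_integral_def diff_divide_distrib)
qed

lemma set_integrable_cis_Icc:
  fixes f :: "real \<Rightarrow> real"
  assumes "continuous_on {a..b} f"
  shows "set_integrable lborel {a..b} (\<lambda>\<xi>. cis (f \<xi>))"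
  unfolding cis_conv_exp by (intro borel_integrable_atLeastAtMost' continuous_intros assms)

text \<open>Parseval: off-diagonal exponentials integrate to zero over a period, and on the diagonal
  the time-dependent phases cancel.\<close>

lemma nn_integral_weyl_sum_square:
  "(\<integral>\<^sup>+ z. indicator {0..2 * pi} z * ennreal ((cmod (weyl_sum N t z))\<^sup>2) \<partial>lborel)
    = ennreal (2 * pi * real N)"
proof -
  let ?S = "{0..2 * pi}"
  define c where "c n n' = cis (t * (real n')\<^sup>2 - t * (real n)\<^sup>2)" for n n'
  define e where "e n n' z = cis (of_int (int n - int n') * z)" for n n' z
  have int_e: "set_integrable lborel ?S (e n n')" for n n'
    unfolding e_def by (intro set_integrable_cis_Icc continuous_intros)
  have lint_e: "(LINT z:?S|lborel. e n n' z) = (if n = n' then 2 * pi else 0)" for n n'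
  proof (cases "n = n'")
    case True
    then show ?thesis by (simp add: e_def set_lebesgue_integral_def scaleR_conv_of_real)
  next
    case False
    then show ?thesis
      using cis_multiple_2pi[of "of_int (int n - int n')"] unfolding e_def
      by (subst set_integral_cis_Icc) (auto simp: mult_ac)
  qed
  have int: "set_integrable lborel ?S (\<lambda>z. (cmod (weyl_sum N t z))\<^sup>2)"
    by (intro borel_integrable_atLeastAtMost' continuous_intros)
  have sq: "complex_of_real ((cmod (weyl_sum N t z))\<^sup>2) = (\<Sum>n<N. \<Sum>n'<N. c n n' * e n n' z)" for z
    unfolding complex_norm_square weyl_sum_def cnj_sum sum_product c_def e_def
    by (intro sum.cong) (auto simp: cis_mult cis_cnj algebra_simps)
  \<comment> \<open>The indicator weight is moved onto each exponential, so that integral and double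
    sum can be exchanged termwise.\<close>
  have scale: "r *\<^sub>R (\<Sum>n<N. \<Sum>n'<N. c n n' * e n n' z) = (\<Sum>n<N. \<Sum>n'<N. c n n' * (r *\<^sub>R e n n' z))"
    for r z by (simp add: scaleR_sum_right)
  have "complex_of_real (LINT z:?S|lborel. (cmod (weyl_sum N t z))\<^sup>2) =
      (LINT z:?S|lborel. \<Sum>n<N. \<Sum>n'<N. c n n' * e n n' z)"
    unfolding sq[symmetric] by (rule set_integral_complex_of_real[symmetric])
  also have "\<dots> = (\<Sum>n<N. (LINT z|lborel. (\<Sum>n'<N. c n n' * (indicator ?S z *\<^sub>R e n n' z))))"
    unfolding set_lebesgue_integral_def scale using int_e unfolding set_integrable_def
    by (intro Bochner_Integration.integral_sum Bochner_Integration.integrable_sum integrable_mult_right)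
  also have "\<dots> = (\<Sum>n<N. \<Sum>n'<N. (LINT z|lborel. c n n' * (indicator ?S z *\<^sub>R e n n' z)))"
    using int_e unfolding set_integrable_def
    by (intro sum.cong refl Bochner_Integration.integral_sum integrable_mult_right)
  also have "\<dots> = (\<Sum>n<N. \<Sum>n'<N. c n n' * (LINT z:?S|lborel. e n n' z))"
    unfolding set_lebesgue_integral_def by (simp only: integral_mult_right_zero)
  also have "\<dots> = (\<Sum>n<N. \<Sum>n'<N. if n' = n then c n n * (2 * pi) else 0)"
    unfolding lint_e by (intro sum.cong) auto
  also have "\<dots> = complex_of_real (2 * pi * real N)"
    by (simp add: c_def)
  finally have "(LINT z:?S|lborel. (cmod (weyl_sum N t z))\<^sup>2) = 2 * pi * real N"
    using of_real_eq_iff by blast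
  moreover have "(\<integral>\<^sup>+ z. indicator ?S z * ennreal ((cmod (weyl_sum N t z))\<^sup>2) \<partial>lborel) =
      (\<integral>\<^sup>+ z. ennreal (indicator ?S z *\<^sub>R (cmod (weyl_sum N t z))\<^sup>2) \<partial>lborel)"
    by (intro nn_integral_cong) (auto split: split_indicator)
  ultimately show ?thesis
    using int unfolding set_lebesgue_integral_def set_integrable_def
    by (subst (asm) nn_integral_eq_integral) auto
qed

text \<open>The wave packet travels with group velocity 2M. Near its centre the phase stays within 1
  of its value at \<xi> = M, so after removal of that value the real part of the integrand is at
  least 1/2 on an interval of length 1/2.\<close>

lemma norm_set_integral_cis_ge:
  fixes M t x :: real
  assumes "0 \<le> t" "t \<le> 1" "\<bar>x - 2 * M * t\<bar> \<le> 1"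
  shows "1 / 4 \<le> cmod (LINT \<xi>:{M..M + 1 / 2}|lborel. cis (x * \<xi> - t * \<xi>\<^sup>2))"
proof -
  let ?S = "{M..M + 1 / 2}"
  let ?f = "\<lambda>\<xi>. x * \<xi> - t * \<xi>\<^sup>2"
  have int: "set_integrable lborel ?S (\<lambda>\<xi>. cis (?f \<xi> - ?f M))"
    by (intro set_integrable_cis_Icc continuous_intros)
  have half: "integrable lborel (\<lambda>\<xi>. indicator ?S \<xi> * (1 / 2 :: real))"
    using borel_integrable_atLeastAtMost'[of M "M + 1 / 2" "\<lambda>_. 1 / 2 :: real"]
    unfolding set_integrable_def real_scaleR_def by simp
  have "1 / 2 \<le> cos (?f \<xi> - ?f M)" if "\<xi> \<in> ?S" for \<xi>
  proof (rule cos_ge_half)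
    define \<eta> where "\<eta> = \<xi> - M"
    have \<eta>: "0 \<le> \<eta>" "\<eta> \<le> 1 / 2" using that by (auto simp: \<eta>_def)
    \<comment> \<open>Expansion about M: the linear term contributes at most 1/2 and the quadratic
      one at most 1/4.\<close>
    have "?f \<xi> - ?f M = \<eta> * (x - 2 * M * t) - t * \<eta>\<^sup>2"
      by (simp add: \<eta>_def power2_eq_square algebra_simps)
    moreover have "\<bar>\<eta> * (x - 2 * M * t)\<bar> \<le> 1 / 2 * 1"
      unfolding abs_mult using \<eta> assms by (intro mult_mono) auto
    moreover have "t * \<eta>\<^sup>2 \<le> 1 * (1 / 2)\<^sup>2"
      using \<eta> assms by (intro mult_mono power_mono) auto
    moreover have "0 \<le> t * \<eta>\<^sup>2" using assms by simp
    ultimately show "\<bar>?f \<xi> - ?f M\<bar> \<le> 1"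
      by (auto simp: abs_le_iff power2_eq_square)
  qed
  then have "(LINT \<xi>|lborel. indicator ?S \<xi> * (1 / 2)) \<le>
      (LINT \<xi>|lborel. indicator ?S \<xi> * cos (?f \<xi> - ?f M))"
    using integrable_Re[OF int[unfolded set_integrable_def]]
    by (intro integral_mono half)
      (auto split: split_indicator)
  also have "\<dots> = Re (LINT \<xi>:?S|lborel. cis (?f \<xi> - ?f M))"
    using int by (simp add: set_lebesgue_integral_def set_integrable_def flip: integral_Re)
  also have "\<dots> \<le> cmod (LINT \<xi>:?S|lborel. cis (?f \<xi> - ?f M))"
    by (rule complex_Re_le_cmod)
  also have "(LINT \<xi>:?S|lborel. cis (?f \<xi> - ?f M)) = (LINT \<xi>:?S|lborel. cis (- ?f M) * cis (?f \<xi>))"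
    by (simp add: cis_mult algebra_simps)
  also have "cmod \<dots> = cmod (LINT \<xi>:?S|lborel. cis (?f \<xi>))"
    by (simp add: norm_mult)
  finally show ?thesis by simp
qed

text \<open>The trivial bound 1/2 serves for small x and the explicit antiderivative, giving
  2/\<bar>x\<bar>, for large x. The right-hand side merges both into one function that is integrable
  in x and independent of M.\<close>

lemma norm_set_integral_cis_square_le:
  fixes M x :: real
  shows "(cmod (LINT \<xi>:{M..M + 1 / 2}|lborel. cis (x * \<xi>)))\<^sup>2 \<le> 8 / (1 + x\<^sup>2)"
proof (cases "x\<^sup>2 \<le> 1")
  case True
  have "cmod (LINT \<xi>:{M..M + 1 / 2}|lborel. cis (x * \<xi>)) \<le>
      (LINT \<xi>|lborel. norm (indicator {M..M + 1 / 2} \<xi> *\<^sub>R cis (x * \<xi>)))"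
    unfolding set_lebesgue_integral_def by (rule integral_norm_bound)
  also have "\<dots> = 1 / 2" by simp
  finally have "(cmod (LINT \<xi>:{M..M + 1 / 2}|lborel. cis (x * \<xi>)))\<^sup>2 \<le> (1 / 2)\<^sup>2"
    by (intro power_mono) auto
  also have "\<dots> \<le> 8 / (1 + x\<^sup>2)"
    using True by (subst pos_le_divide_eq) (auto simp: power2_eq_square add_pos_nonneg)
  finally show ?thesis .
next
  case False
  then have x: "x \<noteq> 0" by auto
  have "cmod (cis (x * (M + 1 / 2)) - cis (x * M)) \<le> 2"
    using norm_triangle_ineq4[of "cis (x * (M + 1 / 2))" "cis (x * M)"] by simp
  then have "cmod (LINT \<xi>:{M..M + 1 / 2}|lborel. cis (x * \<xi>)) \<le> 2 / \<bar>x\<bar>"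
    using x by (simp add: set_integral_cis_Icc norm_divide norm_mult divide_right_mono)
  then have "(cmod (LINT \<xi>:{M..M + 1 / 2}|lborel. cis (x * \<xi>)))\<^sup>2 \<le> (2 / \<bar>x\<bar>)\<^sup>2"
    by (intro power_mono) auto
  also have "\<dots> \<le> 8 / (1 + x\<^sup>2)"
    using False x by (simp add: power_divide field_simps)
  finally show ?thesis .
qed

lemma cis_sum: "cis (\<Sum>i\<in>A. f i) = (\<Prod>i\<in>A. cis (f i))"
  by (induction A rule: infinite_finite_induct) (auto simp flip: cis_mult)

lemma sum_inverse_squares_le_2: "(\<Sum>k=1..n. 1 / (real k)\<^sup>2) \<le> 2"
proof -
  \<comment> \<open>The bound is strengthened by the telescoping term 1/(n + 1) to make the
    induction work; starting at \<open>Suc n\<close> avoids division by zero.\<close>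
  have "(\<Sum>k=1..Suc n. 1 / (real k)\<^sup>2) \<le> 2 - 1 / real (Suc n)" for n
  proof (induction n)
    case (Suc n)
    have "1 / (real (Suc (Suc n)))\<^sup>2 \<le> 1 / real (Suc n) - 1 / real (Suc (Suc n))"
      by (rule order_trans[of _ "1 / (real (Suc n) * real (Suc (Suc n)))"])
        (auto simp: power2_eq_square diff_frac_eq intro!: frac_le)
    with Suc show ?case by simp
  qed simp
  from this[of n] have "(\<Sum>k=1..n. 1 / (real k)\<^sup>2) \<le> 2 - 1 / real (Suc n) - 1 / (real (Suc n))\<^sup>2"
    by simp
  moreover have "0 \<le> 1 / real (Suc n)" "0 \<le> 1 / (real (Suc n))\<^sup>2"
    by simp_all
  ultimately show ?thesis by linarith
qed

subsection \<open>Reduced fractions\<close>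

text \<open>The fractions a/q are kept below 1/16 so that the times 2 pi a/q lie in [0, 1/2].\<close>

definition reduced_fractions :: "nat \<Rightarrow> (nat \<times> nat) set" where
  "reduced_fractions Q = {(q, a). 0 < q \<and> q \<le> Q \<and> 16 * a \<le> q \<and> coprime a q}"

lemma finite_reduced_fractions [simp]: "finite (reduced_fractions Q)"
  by (rule finite_subset[of _ "{..Q} \<times> {..Q}"]) (auto simp: reduced_fractions_def)

lemma harm_le_sum_reduced_fractions:
  "harm Q / 32 \<le> (\<Sum>(q, a)\<in>reduced_fractions Q. 1 / (real q)\<^sup>2)"
proof -
  let ?R = "reduced_fractions Q"
  \<comment> \<open>All fractions up to 1/16, reduced or not: each q admits q div 16 + 1 numerators,
    so weighting by 1/q^2 yields at least \<open>harm Q / 16\<close>.\<close>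
  define A where "A = (SIGMA q:{1..Q}. {a. 16 * a \<le> q})"
  have fin: "finite {a :: nat. 16 * a \<le> q}" for q
    by (rule finite_subset[of _ "{..q}"]) auto
  have "harm Q / 16 = (\<Sum>q=1..Q. (real q / 16) * (1 / (real q)\<^sup>2))"
    unfolding harm_def sum_divide_distrib
    by (intro sum.cong) (auto simp: field_simps power2_eq_square)
  also have "\<dots> \<le> (\<Sum>q=1..Q. real (card {a. 16 * a \<le> q}) * (1 / (real q)\<^sup>2))"
  proof (intro sum_mono mult_right_mono)
    fix q :: nat
    have "{a. 16 * a \<le> q} = {..q div 16}" by auto
    then show "real q / 16 \<le> real (card {a. 16 * a \<le> q})" by simp
  qed auto
  also have "\<dots> = (\<Sum>(q, a)\<in>A. 1 / (real q)\<^sup>2)"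
    unfolding A_def by (subst sum.Sigma[symmetric]) (auto simp: fin)
  \<comment> \<open>Each a/q arises from its reduced form by a common factor k, at a total cost of a factor
    at most the sum of the 1/k^2.\<close>
  also have "\<dots> \<le> (\<Sum>(k, q, a)\<in>{1..Q} \<times> ?R. 1 / (real (k * q))\<^sup>2)"
  proof (rule sum_le_included[where i = "\<lambda>(k, q, a). (k * q, k * a)"])
    show "\<forall>x\<in>A. \<exists>y\<in>{1..Q} \<times> ?R. (case y of (k, q, a) \<Rightarrow> (k * q, k * a)) = x \<and>
        (case x of (q, a) \<Rightarrow> 1 / (real q)\<^sup>2) \<le> (case y of (k, q, a) \<Rightarrow> 1 / (real (k * q))\<^sup>2)"
    proof
      fix x assume "x \<in> A"
      then obtain q a where x: "x = (q, a)" "1 \<le> q" "q \<le> Q" "16 * a \<le> q"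
        by (auto simp: A_def)
      define k where "k = gcd a q"
      obtain a' q' where k: "a = a' * k" "q = q' * k" "coprime a' q'"
        using gcd_coprime_exists[of a q] x(2) unfolding k_def by force
      have pos: "0 < k" "0 < q'" using x(2) k(2) by (auto intro: Nat.gr0I)
      then have "k \<le> q" "q' \<le> q" using k(2) by auto
      moreover have "16 * a' \<le> q'" using x(4) pos(1) unfolding k by simp
      ultimately have "(k, q', a') \<in> {1..Q} \<times> ?R"
        using x k(3) pos by (auto simp: reduced_fractions_def)
      then show "\<exists>y\<in>{1..Q} \<times> ?R. (case y of (k, q, a) \<Rightarrow> (k * q, k * a)) = x \<and>
          (case x of (q, a) \<Rightarrow> 1 / (real q)\<^sup>2) \<le> (case y of (k, q, a) \<Rightarrow> 1 / (real (k * q))\<^sup>2)"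
        by (rule bexI[rotated]) (simp add: x k mult.commute)
    qed
  qed (auto simp: A_def fin)
  also have "\<dots> = (\<Sum>k=1..Q. 1 / (real k)\<^sup>2) * (\<Sum>(q, a)\<in>?R. 1 / (real q)\<^sup>2)"
    unfolding sum_product by (subst sum.cartesian_product) (auto intro!: sum.cong simp: power_mult_distrib)
  also have "\<dots> \<le> 2 * (\<Sum>(q, a)\<in>?R. 1 / (real q)\<^sup>2)"
    by (intro mult_right_mono sum_inverse_squares_le_2 sum_nonneg) auto
  finally show ?thesis by simp
qed

text \<open>Distinct fractions with denominators at most Q differ by at least 1/Q^2, so the
  corresponding times are at least 2 pi/Q^2 apart, more than the interval length.\<close>

lemma disjoint_reduced_fraction_intervals:
  assumes "0 < Q"
  shows "disjoint_family_on (\<lambda>(q, a). {2 * pi * real a / real q ..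
    2 * pi * real a / real q + 1 / (2 * (real Q)\<^sup>2)}) (reduced_fractions Q)"
proof -
  define \<delta> where "\<delta> = 1 / (2 * (real Q)\<^sup>2)"
  have sep: "2 * pi * real a / real q + \<delta> < 2 * pi * real a' / real q'"
    if "(q, a) \<in> reduced_fractions Q" "(q', a') \<in> reduced_fractions Q" "a * q' < a' * q" for q a q' a'
  proof -
    have q: "0 < q" "q \<le> Q" "0 < q'" "q' \<le> Q"
      using that by (auto simp: reduced_fractions_def)
    have diff: "1 \<le> real (a' * q) - real (a * q')"
      using that(3) by linarith
    have "1 * 1 / (real Q * real Q) < 2 * pi * 2 * (1 / (real Q * real Q))"
      using assms pi_gt3 by (simp add: divide_simps)
    then have "\<delta> < 2 * pi * (1 / (real Q * real Q))"
      by (simp add: \<delta>_def power2_eq_square)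
    also have "\<dots> \<le> 2 * pi * (1 / (real q * real q'))"
      using q by (intro mult_left_mono divide_left_mono mult_mono) auto
    also have "\<dots> \<le> 2 * pi * ((real (a' * q) - real (a * q')) / (real q * real q'))"
      using diff by (intro mult_left_mono divide_right_mono) auto
    also have "\<dots> = 2 * pi * real a' / real q' - 2 * pi * real a / real q"
      using q by (simp add: field_simps)
    finally show ?thesis by simp
  qed
  \<comment> \<open>Two reduced fractions of equal value have the same numerator and denominator, so
    distinct pairs give distinct times.\<close>
  have ne: "a * q' \<noteq> a' * q"
    if "(q, a) \<in> reduced_fractions Q" "(q', a') \<in> reduced_fractions Q" "(q, a) \<noteq> (q', a')" for q a q' a'
    using that coprime_crossproduct_nat[of a q a' q']
    by (auto simp: reduced_fractions_def coprime_commute mult.commute)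
  show ?thesis
    unfolding \<delta>_def[symmetric] disjoint_family_on_def
  proof (intro ballI impI)
    fix x y assume xy: "x \<in> reduced_fractions Q" "y \<in> reduced_fractions Q" "x \<noteq> y"
    obtain q a q' a' where *: "x = (q, a)" "y = (q', a')" by (metis surj_pair)
    have "a * q' \<noteq> a' * q" using ne xy * by blast
    then consider "a * q' < a' * q" | "a' * q < a * q'" by linarith
    then show "(case x of (q, a) \<Rightarrow> {2 * pi * real a / real q..2 * pi * real a / real q + \<delta>}) \<inter>
        (case y of (q, a) \<Rightarrow> {2 * pi * real a / real q..2 * pi * real a / real q + \<delta>}) = {}"
      using sep[of q a q' a'] sep[of q' a' q a] xy * by cases auto
  qed
qed

subsection \<open>The datum and its evolution\<close>

text \<open>The length 1/2 in \<xi> keeps the oscillation of the \<xi>-integral under control for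
  all times in [0, 1] along the ray x = 2Mt.\<close>

definition datum :: "real \<Rightarrow> nat \<Rightarrow> real \<times> (int ^ 'm) \<Rightarrow> complex" where
  "datum M N = (\<lambda>(\<xi>, n). if \<xi> \<in> {M..M + 1 / 2} \<and> (\<forall>i. n $ i \<in> {0..<int N}) then 1 else 0)"

text \<open>Distributivity, with integer vectors in the box identified with functions from the index
  type.\<close>

lemma sum_box_prod:
  fixes f :: "'m::finite \<Rightarrow> int \<Rightarrow> complex"
  shows "(\<Sum>n\<in>{n :: int ^ 'm. \<forall>i. n $ i \<in> {0..<int N}}. \<Prod>i\<in>UNIV. f i (n $ i)) =
    (\<Prod>i\<in>UNIV. \<Sum>k<N. f i (int k))"
proof -
  have "(\<Prod>i\<in>UNIV. \<Sum>k<N. f i (int k)) = (\<Prod>i\<in>UNIV. \<Sum>k\<in>{0..<int N}. f i k)"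
    by (intro prod.cong refl sum.reindex_bij_witness[of _ nat int]) auto
  also have "\<dots> = (\<Sum>h\<in>UNIV \<rightarrow>\<^sub>E {0..<int N}. \<Prod>i\<in>UNIV. f i (h i))"
    by (rule prod_sum_PiE) auto
  also have "\<dots> = (\<Sum>n\<in>{n :: int ^ 'm. \<forall>i. n $ i \<in> {0..<int N}}. \<Prod>i\<in>UNIV. f i (n $ i))"
    by (intro sum.reindex_bij_witness[of _ vec_nth vec_lambda]) (auto simp: PiE_def Pi_def)
  finally show ?thesis ..
qed

text \<open>The squared frequency norm is a sum over coordinates and the datum is the indicator of a
  product set, so the evolution factors into one-dimensional pieces.\<close>

lemma schrod_datum:
  fixes y :: "real ^ 'm::finite"
  shows "schrod (datum M N) t x y =
    (LINT \<xi>:{M..M + 1 / 2}|lborel. cis (x * \<xi> - t * \<xi>\<^sup>2)) * (\<Prod>i\<in>UNIV. weyl_sum N t (y $ i))"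
proof -
  let ?F = "LINT \<xi>:{M..M + 1 / 2}|lborel. cis (x * \<xi> - t * \<xi>\<^sup>2)"
  let ?B = "{n :: int ^ 'm. \<forall>i. n $ i \<in> {0..<int N}}"
  \<comment> \<open>The index set of the sum in \<open>schrod\<close> is exactly the integer box;
    \<xi> = M witnesses that each of its points occurs.\<close>
  have supp: "{n :: int ^ 'm. \<exists>\<xi>. datum M N (\<xi>, n) \<noteq> 0} = ?B"
    by (auto simp: datum_def intro!: exI[of _ M])
  have "(LINT \<xi>|lborel. datum M N (\<xi>, n) * cis (x * \<xi> + dot_int n y - t * (freq_norm \<xi> n)\<^sup>2)) =
      ?F * (\<Prod>i\<in>UNIV. cis (of_int (n $ i) * y $ i - t * (of_int (n $ i))\<^sup>2))" (is "?L = ?F * ?P")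
    if "n \<in> ?B" for n
  proof -
    have sq: "(freq_norm \<xi> n)\<^sup>2 = \<xi>\<^sup>2 + (\<Sum>i\<in>UNIV. (real_of_int (n $ i))\<^sup>2)" for \<xi>
      unfolding freq_norm_def by (simp add: sum_nonneg)
    have "?P = cis (dot_int n y - t * (\<Sum>i\<in>UNIV. (real_of_int (n $ i))\<^sup>2))"
      by (simp add: cis_sum[symmetric] dot_int_def sum_subtractf sum_distrib_left)
    then have "cis (x * \<xi> + dot_int n y - t * (freq_norm \<xi> n)\<^sup>2) = cis (x * \<xi> - t * \<xi>\<^sup>2) * ?P" for \<xi>
      unfolding sq by (simp add: cis_mult algebra_simps)
    then have "?L = (LINT \<xi>|lborel. (indicator {M..M + 1 / 2} \<xi> *\<^sub>R cis (x * \<xi> - t * \<xi>\<^sup>2)) * ?P)"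
      using that by (intro Bochner_Integration.integral_cong) (auto simp: datum_def split: split_indicator)
    then show ?thesis
      unfolding set_lebesgue_integral_def by (simp only: integral_mult_left_zero)
  qed
  then show ?thesis
    unfolding schrod_def supp weyl_sum_def
    using sum_box_prod[where N = N and f = "\<lambda>i k. cis (of_int k * y $ i - t * (of_int k)\<^sup>2)"]
    by (simp flip: sum_distrib_left)
qed

lemma enn_root_mono:
  assumes "p > 0" "0 \<le> c" "ennreal c \<le> I"
  shows "ennreal (c powr (1 / p)) \<le> enn_root p I"
proof (cases "I = \<infinity>")
  case False
  then have "c \<le> enn2real I"
    using assms(2,3) by (metis enn2real_ennreal enn2real_mono infinity_ennreal_def top.not_eq_extremum)
  then show ?thesis
    using assms False by (auto simp: enn_root_def intro!: ennreal_leI powr_mono2)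
qed (simp add: enn_root_def)

lemma enn_root_le:
  assumes "p > 0" "0 \<le> c" "I \<le> ennreal c"
  shows "enn_root p I \<le> ennreal (c powr (1 / p))"
proof -
  have "I \<noteq> \<infinity>" using assms(3) by (auto simp: top_unique)
  moreover have "enn2real I \<le> c"
    using enn2real_mono[OF assms(3)] assms(2) by simp
  ultimately show ?thesis
    using assms by (auto simp: enn_root_def intro!: ennreal_leI powr_mono2)
qed

section \<open>Lower bound for the space-time norm\<close>

text \<open>At such a time each torus variable contributes the factor \<open>K\<close> of the
  one-dimensional bound, and x ranges over an interval of length 2 around 2Mt. The endpoint
  exponent, in the form r * m = m + 2, makes the dependence on q exactly 1/q^2.\<close>

lemma nn_integral_schrod_datum_ge:
  fixes M :: real
  assumes R: "(q, a) \<in> reduced_fractions N"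
    and p: "p = 2 * r" "r > 1" "r * real CARD('m::finite) = real CARD('m) + 2"
    and M: "0 \<le> t" "t \<le> 1"
    and t: "t \<in> {2 * pi * real a / real q .. 2 * pi * real a / real q + 1 / (2 * (real N)\<^sup>2)}"
  shows "ennreal (2 * (1 / 4) powr p * (real N ^ (CARD('m) + 4) / ((real q)\<^sup>2 * 2 ^ (3 * CARD('m) + 4)))) \<le>
    (\<integral>\<^sup>+ x. (\<integral>\<^sup>+ y. indicator torus_box y *
      ennreal (cmod (schrod (datum M N) t x (y :: real ^ 'm)) powr p) \<partial>lborel) \<partial>lborel)"
proof -
  let ?m = "CARD('m)"
  let ?w = "\<lambda>z. cmod (weyl_sum N t z) powr p"
  define f where "f z = indicator {0..2 * pi} z * ennreal (?w z)" for z
  have f [measurable]: "f \<in> borel_measurable borel"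
    unfolding f_def by measurable
  have q: "0 < q" "q \<le> N" using R by (auto simp: reduced_fractions_def)
  define K where "K = real q / (2 * real N) * ((real N)\<^sup>2 / (4 * real q)) powr r"
  \<comment> \<open>The endpoint relation turns the real exponent r * m into the natural number m +
    2.\<close>
  have "(((real N)\<^sup>2 / (4 * real q)) powr r) ^ ?m = ((real N)\<^sup>2 / (4 * real q)) powr (real (?m + 2))"
    using q p(3) by (simp add: powr_power mult.commute add.commute)
  also have "\<dots> = ((real N)\<^sup>2 / (4 * real q)) ^ (?m + 2)"
    using q by (intro powr_realpow) auto
  finally have "K ^ ?m = (real q / (2 * real N)) ^ ?m * ((real N)\<^sup>2 / (4 * real q)) ^ (?m + 2)"
    by (simp only: K_def power_mult_distrib)
  also have "\<dots> = real N ^ (?m + 4) / ((real q)\<^sup>2 * 2 ^ (3 * ?m + 4))"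
  proof -
    have "(4 :: real) ^ (?m + 2) = 2 ^ (2 * ?m + 4)"
      by (simp add: power_add power_mult)
    then show ?thesis
      using q by (simp add: power_divide power_mult_distrib power_add field_simps
          flip: power_mult) (simp add: power_add mult_2_right eval_nat_numeral field_simps)
  qed
  finally have K: "K ^ ?m = real N ^ (?m + 4) / ((real q)\<^sup>2 * 2 ^ (3 * ?m + 4))" .
  define I where "I = (\<lambda>x. \<integral>\<^sup>+ y. indicator torus_box y *
      ennreal (cmod (schrod (datum M N) t x (y :: real ^ 'm)) powr p) \<partial>lborel)"
  have "ennreal K \<le> integral\<^sup>N lborel f"
    using nn_integral_weyl_sum_powr_ge[OF q, of "t - 2 * pi * real a / real q" r a] t p
    unfolding K_def f_def by simp
  then have "ennreal ((1 / 4) powr p) * ennreal K ^ ?m \<le> ennreal ((1 / 4) powr p) * integral\<^sup>N lborel f ^ ?m"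
    by (intro mult_left_mono power_mono) auto
  also have "\<dots> = (\<integral>\<^sup>+ y. ennreal ((1 / 4) powr p) * (\<Prod>i\<in>UNIV. f (y $ i)) \<partial>(lborel :: (real ^ 'm) measure))"
    by (subst nn_integral_cmult) (simp_all add: nn_integral_vec_prod)
  finally have low: "ennreal ((1 / 4) powr p * K ^ ?m) \<le>
      (\<integral>\<^sup>+ y. ennreal ((1 / 4) powr p) * (\<Prod>i\<in>UNIV. f (y $ i)) \<partial>(lborel :: (real ^ 'm) measure))"
    using q by (simp add: ennreal_mult' ennreal_power K_def)
  have I: "ennreal ((1 / 4) powr p * K ^ ?m) \<le> I x" if x: "\<bar>x - 2 * M * t\<bar> \<le> 1" for x
    unfolding I_def
  proof (rule order_trans[OF low], intro nn_integral_mono)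
    fix y :: "real ^ 'm"
    \<comment> \<open>The factor 1/4 bounds the \<xi>-integral from below; the remaining factors are
      the Weyl sums.\<close>
    have "(1 / 4) powr p * (\<Prod>i\<in>UNIV. ?w (y $ i)) \<le> cmod (schrod (datum M N) t x y) powr p"
      unfolding schrod_datum norm_mult prod_norm[symmetric] powr_mult
      using p norm_set_integral_cis_ge[OF M x]
      by (subst prod_powr_distrib[symmetric], simp)
        (intro mult_right_mono powr_mono2, auto)
    then have "ennreal ((1 / 4) powr p) * (\<Prod>i\<in>UNIV. ennreal (?w (y $ i))) \<le>
        ennreal (cmod (schrod (datum M N) t x y) powr p)"
      by (simp add: prod_ennreal ennreal_leI flip: ennreal_mult')
    then have "indicator torus_box y * (ennreal ((1 / 4) powr p) * (\<Prod>i\<in>UNIV. ennreal (?w (y $ i)))) \<le>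
        indicator torus_box y * ennreal (cmod (schrod (datum M N) t x y) powr p)"
      by (intro mult_left_mono) auto
    then show "ennreal ((1 / 4) powr p) * (\<Prod>i\<in>UNIV. f (y $ i)) \<le>
        indicator torus_box y * ennreal (cmod (schrod (datum M N) t x y) powr p)"
      unfolding f_def prod.distrib indicator_torus_box by (simp add: mult_ac)
  qed
  have "ennreal (2 * (1 / 4) powr p * K ^ ?m) =
      ennreal ((1 / 4) powr p * K ^ ?m) * emeasure lborel {2 * M * t - 1..2 * M * t + 1}"
    using q by (simp add: K_def mult_ac flip: ennreal_mult'' ennreal_numeral)
  also have "\<dots> = (\<integral>\<^sup>+ x. ennreal ((1 / 4) powr p * K ^ ?m) * indicator {2 * M * t - 1..2 * M * t + 1} x \<partial>lborel)"
    by (subst nn_integral_cmult_indicator) auto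
  also have "\<dots> \<le> (\<integral>\<^sup>+ x. I x \<partial>lborel)"
    by (intro nn_integral_mono) (auto split: split_indicator intro!: I)
  finally show ?thesis unfolding I_def K .
qed

text \<open>The time intervals around distinct reduced fractions are disjoint subsets of [0, 1], so
  their contributions add up. The sum of 1/q^2 then produces the logarithmic factor
  \<open>harm N\<close>.\<close>

lemma Lp_norm_schrod_datum_ge:
  assumes p: "p = 2 * r" "r > 1" "r * real CARD('m::finite) = real CARD('m) + 2"
    and N: "N > 0"
  shows "ennreal (((1 / 4) powr p / 2 ^ (3 * CARD('m) + 9) * real N ^ (CARD('m) + 2) * harm N) powr (1 / p))
    \<le> Lp_norm_01 p (schrod (datum M N :: real \<times> (int ^ 'm) \<Rightarrow> complex))"
proof -
  let ?m = "CARD('m)"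
  let ?R = "reduced_fractions N"
  define J where "J = (\<lambda>(q, a). {2 * pi * real a / real q .. 2 * pi * real a / real q + 1 / (2 * (real N)\<^sup>2)})"
  define k where "k = (\<lambda>(q :: nat, a :: nat). 2 * (1 / 4) powr p *
    (real N ^ (?m + 4) / ((real q)\<^sup>2 * 2 ^ (3 * ?m + 4))))"
  define I where "I = (\<lambda>t. \<integral>\<^sup>+ x. (\<integral>\<^sup>+ y. indicator torus_box y *
      ennreal (cmod (schrod (datum M N) t x (y :: real ^ 'm)) powr p) \<partial>lborel) \<partial>lborel)"
  have disj: "disjoint_family_on J ?R"
    unfolding J_def by (rule disjoint_reduced_fraction_intervals[OF N])
  have J: "J s \<subseteq> {0..1}" if s: "s \<in> ?R" for s
  proof -
    obtain q a where s': "s = (q, a)" by force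
    have q: "0 < q" "16 * real a \<le> real q" using s by (auto simp: s' reduced_fractions_def)
    have "2 * pi * real a / real q \<le> 2 * pi * (1 / 16)"
      using q by (simp add: field_simps)
    also have "\<dots> \<le> 1 / 2" using pi_less_4 by simp
    finally have "2 * pi * real a / real q \<le> 1 / 2" .
    moreover have "1 / (2 * (real N)\<^sup>2) \<le> 1 / 2" using N by simp
    moreover have "0 \<le> 2 * pi * real a / real q" by simp
    ultimately show ?thesis unfolding J_def s' by auto
  qed
  have J_measure: "emeasure lborel (J s) = ennreal (1 / (2 * (real N)\<^sup>2))" for s
    by (cases s) (simp add: J_def)
  have k0: "0 \<le> k s" for s by (auto simp: k_def split: prod.split)
  \<comment> \<open>The interval length 1/(2N^2) lowers N^(m+4) to N^(m+2) and cancels the 2 in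
    \<open>k\<close>; the loss of 32 = 2^5 for reduced fractions raises the exponent of 2 to 3m +
    9.\<close>
  have "(\<Sum>s\<in>?R. 1 / (2 * (real N)\<^sup>2) * k s) =
      ((1 / 4) powr p / 2 ^ (3 * ?m + 4) * real N ^ (?m + 2)) * (\<Sum>(q, a)\<in>?R. 1 / (real q)\<^sup>2)"
    unfolding sum_distrib_left using N
    by (intro sum.cong) (auto simp: k_def field_simps power_add eval_nat_numeral)
  also have "\<dots> \<ge> ((1 / 4) powr p / 2 ^ (3 * ?m + 4) * real N ^ (?m + 2)) * (harm N / 32)"
    by (intro mult_left_mono harm_le_sum_reduced_fractions) auto
  also have "((1 / 4) powr p / 2 ^ (3 * ?m + 4) * real N ^ (?m + 2)) * (harm N / 32) =
      (1 / 4) powr p / 2 ^ (3 * ?m + 9) * real N ^ (?m + 2) * harm N"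
    by (simp add: power_add)
  finally have "ennreal ((1 / 4) powr p / 2 ^ (3 * ?m + 9) * real N ^ (?m + 2) * harm N) \<le>
      ennreal (\<Sum>s\<in>?R. 1 / (2 * (real N)\<^sup>2) * k s)"
    by (rule ennreal_leI)
  also have "\<dots> = (\<Sum>s\<in>?R. ennreal (k s) * emeasure lborel (J s))"
    using k0 by (subst sum_ennreal[symmetric])
      (auto intro!: sum.cong simp: J_measure mult.commute simp flip: ennreal_mult')
  also have "\<dots> = (\<Sum>s\<in>?R. \<integral>\<^sup>+ t. ennreal (k s) * indicator (J s) t \<partial>lborel)"
    by (intro sum.cong refl nn_integral_cmult_indicator[symmetric]) (auto simp: J_def)
  also have "\<dots> = (\<integral>\<^sup>+ t. (\<Sum>s\<in>?R. ennreal (k s) * indicator (J s) t) \<partial>lborel)"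
    by (intro nn_integral_sum[symmetric]) (auto simp: J_def)
  also have "\<dots> \<le> (\<integral>\<^sup>+ t. indicator {0..1} t * I t \<partial>lborel)"
  proof (intro nn_integral_mono)
    fix t :: real
    have "(\<Sum>s\<in>?R. ennreal (k s) * indicator (J s) t) \<le> (\<Sum>s\<in>?R. indicator (J s) t * I t)"
    proof (intro sum_mono)
      fix s assume s: "s \<in> ?R"
      obtain q a where s': "s = (q, a)" by force
      show "ennreal (k s) * indicator (J s) t \<le> indicator (J s) t * I t"
      proof (cases "t \<in> J s")
        case True
        then have "0 \<le> t" "t \<le> 1" using J[OF s] by auto
        then show ?thesis
          using nn_integral_schrod_datum_ge[OF s[unfolded s'] p, of t M] True
          by (simp add: k_def J_def I_def s')
      qed simp
    qed
    \<comment> \<open>By disjointness no time is counted twice.\<close>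
    also have "\<dots> = indicator (\<Union>s\<in>?R. J s) t * I t"
      by (subst indicator_UN_disjoint[OF _ disj]) (simp_all add: sum_distrib_right)
    also have "\<dots> \<le> indicator {0..1} t * I t"
      by (intro mult_right_mono indicator_leI, use J in blast, simp)
    finally show "(\<Sum>s\<in>?R. ennreal (k s) * indicator (J s) t) \<le> indicator {0..1} t * I t" .
  qed
  finally show ?thesis
    unfolding Lp_norm_01_def I_def using p
    by (intro enn_root_mono) (auto simp: harm_nonneg)
qed

section \<open>Upper bound for the mass of the datum\<close>

lemma nn_integral_inverse_1_plus_square:
  "(\<integral>\<^sup>+ x. ennreal (8 / (1 + x\<^sup>2)) \<partial>lborel) = ennreal (8 * pi)"
proof -
  have "integrable lborel (\<lambda>x :: real. inverse (1 + x\<^sup>2))" "(LBINT x. inverse (1 + x\<^sup>2)) = pi"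
    using integrable_inverse_1_plus_square LBINT_inverse_1_plus_square
    by (simp_all add: set_integrable_def interval_lebesgue_integral_def set_lebesgue_integral_def)
  then have "integrable lborel (\<lambda>x :: real. 8 * inverse (1 + x\<^sup>2))"
    "(LBINT x. 8 * inverse (1 + x\<^sup>2)) = 8 * pi"
    by simp_all
  then show ?thesis
    by (subst nn_integral_eq_integral) (auto simp: divide_inverse add_nonneg_nonneg)
qed

text \<open>At time 0 the square of the modulus factors: Parseval handles each torus variable, and
  the decay in x of the \<xi>-integral handles the line. The bound does not depend on M.\<close>

lemma L2_norm_schrod_datum_le:
  "L2_norm (schrod (datum M N :: real \<times> (int ^ 'm::finite) \<Rightarrow> complex) 0)
    \<le> ennreal ((8 * pi * (2 * pi * real N) ^ CARD('m)) powr (1 / 2))"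
proof -
  let ?m = "CARD('m)"
  let ?F = "\<lambda>x. LINT \<xi>:{M..M + 1 / 2}|lborel. cis (x * \<xi>)"
  define f where "f z = indicator {0..2 * pi} z * ennreal ((cmod (weyl_sum N 0 z))\<^sup>2)" for z
  have f [measurable]: "f \<in> borel_measurable borel"
    unfolding f_def by measurable
  have "(\<integral>\<^sup>+ y. indicator torus_box y * ennreal ((cmod (schrod (datum M N) 0 x (y :: real ^ 'm)))\<^sup>2) \<partial>lborel)
      = ennreal ((cmod (?F x))\<^sup>2) * ennreal ((2 * pi * real N) ^ ?m)" for x
  proof -
    have "indicator torus_box y * ennreal ((cmod (schrod (datum M N) 0 x (y :: real ^ 'm)))\<^sup>2) =
        ennreal ((cmod (?F x))\<^sup>2) * (\<Prod>i\<in>UNIV. f (y $ i))" for y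
      unfolding f_def prod.distrib indicator_torus_box schrod_datum
      by (simp add: norm_mult power_mult_distrib prod_norm[symmetric] prod_power_distrib
          ennreal_mult prod_nonneg prod_ennreal mult_ac)
    then show ?thesis
      by (simp add: nn_integral_cmult nn_integral_vec_prod)
        (simp add: f_def nn_integral_weyl_sum_square ennreal_power)
  qed
  then have "(\<integral>\<^sup>+ x. (\<integral>\<^sup>+ y. indicator torus_box y *
        ennreal ((cmod (schrod (datum M N) 0 x (y :: real ^ 'm)))\<^sup>2) \<partial>lborel) \<partial>lborel)
      \<le> (\<integral>\<^sup>+ x. ennreal (8 / (1 + x\<^sup>2)) * ennreal ((2 * pi * real N) ^ ?m) \<partial>lborel)"
    by (auto intro!: nn_integral_mono mult_right_mono ennreal_leI norm_set_integral_cis_square_le)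
  also have "\<dots> = ennreal (8 * pi * (2 * pi * real N) ^ ?m)"
    by (subst nn_integral_multc) (simp_all add: nn_integral_inverse_1_plus_square ennreal_mult')
  finally show ?thesis
    unfolding L2_norm_def by (intro enn_root_le) auto
qed

section \<open>Frequency support and the contradiction\<close>

text \<open>For M this large the transverse part satisfies \<bar>n\<bar>^2 \<le> M - 1, so the
  annulus is flat at the scale of the datum: (M + 1/2)^2 + M - 1 \<le> (M + 1)^2. The radius M of
  the ball likewise covers 1/4 + M - 1 \<le> M^2.\<close>

lemma datum_support:
  fixes n :: "int ^ 'm::finite"
  assumes "datum M N (\<xi>, n) \<noteq> 0" "1 + real CARD('m) * (real N)\<^sup>2 \<le> M"
  shows "M - 1 \<le> freq_norm \<xi> n \<and> freq_norm \<xi> n \<le> M + 1 \<and> in_ball (M, 0) M \<xi> n"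
proof -
  have \<xi>: "M \<le> \<xi>" "\<xi> \<le> M + 1 / 2" and n: "0 \<le> n $ i" "n $ i < int N" for i
    using assms(1) by (auto simp: datum_def split: if_splits)
  have le: "real_of_int (n $ i) \<le> real N" for i
    using n(2)[of i] by linarith
  define S where "S = (\<Sum>i\<in>UNIV. (real_of_int (n $ i))\<^sup>2)"
  have "S \<le> (\<Sum>i\<in>(UNIV :: 'm set). (real N)\<^sup>2)"
    unfolding S_def using n le by (intro sum_mono power_mono) auto
  then have S: "S \<le> M - 1" using assms(2) by simp
  have S0: "0 \<le> S" unfolding S_def by (intro sum_nonneg) auto
  have M: "M \<ge> 1" using assms(2) by (smt (verit) mult_nonneg_nonneg of_nat_0_le_iff zero_le_power2)
  have "M - 1 \<le> sqrt (\<xi>\<^sup>2 + S)"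
    using \<xi> S0 M by (intro real_le_rsqrt) (smt (verit) power_mono)
  moreover have "sqrt (\<xi>\<^sup>2 + S) \<le> M + 1"
  proof (rule real_le_lsqrt)
    have "\<xi>\<^sup>2 \<le> (M + 1 / 2)\<^sup>2" using \<xi> M by (intro power_mono) auto
    then show "\<xi>\<^sup>2 + S \<le> (M + 1)\<^sup>2" using S M by (simp add: power2_eq_square algebra_simps)
  qed (use M in auto)
  moreover have "(\<xi> - M)\<^sup>2 + S \<le> M\<^sup>2"
  proof -
    have "(\<xi> - M)\<^sup>2 \<le> (1 / 2)\<^sup>2" using \<xi> by (intro power_mono) auto
    moreover have "M * 1 \<le> M\<^sup>2" unfolding power2_eq_square using M by (intro mult_left_mono) auto
    ultimately show ?thesis using S by (simp add: power2_eq_square)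
  qed
  ultimately show ?thesis
    unfolding freq_norm_def in_ball_def S_def by simp
qed

theorem theorem1p3:
  fixes d :: nat and p :: real
  assumes "d = CARD('m::finite) + 1"
    and "p = 2 * (real d + 1) / (real d - 1)"
  shows "\<not> (\<exists>C::real. C > 0 \<and>
     (\<forall>(k1::nat) (k2::nat) (cstar::real) (c::real \<times> (real ^ 'm)) (g::real \<times> (int ^ 'm) \<Rightarrow> complex).
        k2 \<le> k1 \<longrightarrow>
        \<bar>cstar - 2 ^ k1\<bar> \<le> 1 \<longrightarrow>
        (\<forall>n. (\<lambda>\<xi>. g (\<xi>, n)) \<in> borel_measurable lborel) \<longrightarrow>
        (\<forall>n. (\<integral>\<^sup>+ \<xi>. ennreal ((cmod (g (\<xi>, n)))\<^sup>2) \<partial>lborel) < \<infinity>) \<longrightarrow>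
        (\<forall>\<xi> n. g (\<xi>, n) \<noteq> 0 \<longrightarrow>
            cstar - 1 \<le> freq_norm \<xi> n \<and> freq_norm \<xi> n \<le> cstar + 1 \<and>
            in_ball c (2 ^ k2) \<xi> n) \<longrightarrow>
        Lp_norm_01 p (schrod g) \<le> ennreal C * L2_norm (schrod g 0)))"
proof (rule notI, elim exE conjE)
  fix C :: real
  let ?m = "CARD('m)"
  \<comment> \<open>Half of p, written with m = d - 1.\<close>
  define r where "r = (real ?m + 2) / real ?m"
  have p: "p = 2 * r" "r > 1" "r * real ?m = real ?m + 2"
    using assms by (auto simp: r_def field_simps)
  assume C: "C > 0" and strichartz: "\<forall>(k1::nat) (k2::nat) (cstar::real) (c::real \<times> (real ^ 'm)) (g::real \<times> (int ^ 'm) \<Rightarrow> complex).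
        k2 \<le> k1 \<longrightarrow>
        \<bar>cstar - 2 ^ k1\<bar> \<le> 1 \<longrightarrow>
        (\<forall>n. (\<lambda>\<xi>. g (\<xi>, n)) \<in> borel_measurable lborel) \<longrightarrow>
        (\<forall>n. (\<integral>\<^sup>+ \<xi>. ennreal ((cmod (g (\<xi>, n)))\<^sup>2) \<partial>lborel) < \<infinity>) \<longrightarrow>
        (\<forall>\<xi> n. g (\<xi>, n) \<noteq> 0 \<longrightarrow>
            cstar - 1 \<le> freq_norm \<xi> n \<and> freq_norm \<xi> n \<le> cstar + 1 \<and>
            in_ball c (2 ^ k2) \<xi> n) \<longrightarrow>
        Lp_norm_01 p (schrod g) \<le> ennreal C * L2_norm (schrod g 0)"
  define A where "A = (1 / 4) powr p / 2 ^ (3 * ?m + 9)"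
  have A: "A > 0" by (simp add: A_def)
  \<comment> \<open>Both sides of the estimate, raised to the power p, scale like N^(m+2); after
    cancellation only \<open>harm N\<close> depends on N.\<close>
  have bound: "harm N \<le> C powr p * ((8 * pi) powr r * (2 * pi) ^ (?m + 2)) / A" if N: "N > 0" for N :: nat
  proof -
    \<comment> \<open>A dyadic M = 2^k that is large against N^2; it serves as both dyadic
      parameters, as the radius of the annulus and as the first coordinate of the ball's
      centre.\<close>
    obtain k :: nat where k: "1 + real ?m * (real N)\<^sup>2 < 2 ^ k"
      using real_arch_pow[of 2] by auto
    let ?g = "datum (2 ^ k) N :: real \<times> (int ^ 'm) \<Rightarrow> complex"
    have meas: "(\<lambda>\<xi>. ?g (\<xi>, n)) \<in> borel_measurable lborel" for n
      unfolding datum_def by simp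
    have fin: "(\<integral>\<^sup>+ \<xi>. ennreal ((cmod (?g (\<xi>, n)))\<^sup>2) \<partial>lborel) < \<infinity>" for n
    proof -
      have "(\<integral>\<^sup>+ \<xi>. ennreal ((cmod (?g (\<xi>, n)))\<^sup>2) \<partial>lborel) \<le> (\<integral>\<^sup>+ \<xi>. indicator {2 ^ k..2 ^ k + 1 :: real} \<xi> \<partial>lborel)"
        by (intro nn_integral_mono) (auto simp: datum_def split: split_indicator)
      also have "\<dots> < \<infinity>" by simp
      finally show ?thesis .
    qed
    have supp: "2 ^ k - 1 \<le> freq_norm \<xi> n \<and> freq_norm \<xi> n \<le> 2 ^ k + 1 \<and> in_ball (2 ^ k, 0) (2 ^ k) \<xi> n"
      if "?g (\<xi>, n) \<noteq> 0" for \<xi> n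
      using datum_support[OF that] k by simp
    have "Lp_norm_01 p (schrod ?g) \<le> ennreal C * L2_norm (schrod ?g 0)"
      using supp by (intro strichartz[rule_format, of k k "2 ^ k" ?g "(2 ^ k, 0)"] meas fin) auto
    also have "\<dots> \<le> ennreal C * ennreal ((8 * pi * (2 * pi * real N) ^ ?m) powr (1 / 2))"
      by (intro mult_left_mono L2_norm_schrod_datum_le) auto
    also have "\<dots> = ennreal (C * (8 * pi * (2 * pi * real N) ^ ?m) powr (1 / 2))"
      using C by (simp flip: ennreal_mult')
    finally have "ennreal ((A * real N ^ (?m + 2) * harm N) powr (1 / p)) \<le>
        ennreal (C * (8 * pi * (2 * pi * real N) ^ ?m) powr (1 / 2))"
      unfolding A_def by (rule order_trans[OF Lp_norm_schrod_datum_ge[OF p N]])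
    then have "(A * real N ^ (?m + 2) * harm N) powr (1 / p) \<le> C * (8 * pi * (2 * pi * real N) ^ ?m) powr (1 / 2)"
      using C by (subst (asm) ennreal_le_iff) auto
    \<comment> \<open>Raising to the power p undoes the root on the left and turns the square root
      on the right into the exponent p/2 = r.\<close>
    then have "((A * real N ^ (?m + 2) * harm N) powr (1 / p)) powr p \<le>
        (C * (8 * pi * (2 * pi * real N) ^ ?m) powr (1 / 2)) powr p"
      using p by (intro powr_mono2) auto
    also have "((A * real N ^ (?m + 2) * harm N) powr (1 / p)) powr p = A * real N ^ (?m + 2) * harm N"
      using p A by (simp add: powr_powr harm_nonneg)
    also have "(C * (8 * pi * (2 * pi * real N) ^ ?m) powr (1 / 2)) powr p =
        C powr p * ((8 * pi) powr r * (((2 * pi * real N) ^ ?m) powr r))"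
    proof -
      have "1 / 2 * p = r" using p(1) by simp
      then show ?thesis by (simp only: powr_mult powr_powr)
    qed
    also have "((2 * pi * real N) ^ ?m) powr r = (2 * pi * real N) ^ (?m + 2)"
    proof -
      have pos: "0 < 2 * pi * real N" using N by simp
      have "((2 * pi * real N) ^ ?m) powr r = (2 * pi * real N) powr (r * real ?m)"
        unfolding powr_realpow[OF pos, symmetric] powr_powr by (simp only: mult.commute)
      also have "\<dots> = (2 * pi * real N) powr real (?m + 2)"
        using p(3) by (simp add: add.commute)
      also have "\<dots> = (2 * pi * real N) ^ (?m + 2)"
        by (rule powr_realpow[OF pos])
      finally show ?thesis .
    qed
    also have "(2 * pi * real N) ^ (?m + 2) = (2 * pi) ^ (?m + 2) * real N ^ (?m + 2)"
      by (rule power_mult_distrib)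
    finally have "real N ^ (?m + 2) * (A * harm N) \<le>
        real N ^ (?m + 2) * (C powr p * ((8 * pi) powr r * (2 * pi) ^ (?m + 2)))"
      by (simp only: mult_ac)
    then have "A * harm N \<le> C powr p * ((8 * pi) powr r * (2 * pi) ^ (?m + 2))"
      using N by (subst (asm) mult_le_cancel_left_pos) auto
    then show ?thesis
      using A by (simp only: pos_le_divide_eq mult.commute[of A])
  qed
  \<comment> \<open>Divergence of the harmonic series contradicts the bound, which is uniform in
    N.\<close>
  have "eventually (\<lambda>N. harm N > C powr p * ((8 * pi) powr r * (2 * pi) ^ (?m + 2)) / A) sequentially"
    using harm_at_top unfolding filterlim_at_top_dense by blast
  then have "eventually (\<lambda>N. 0 < N \<and> harm N > C powr p * ((8 * pi) powr r * (2 * pi) ^ (?m + 2)) / A) sequentially"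
    by (rule eventually_conj[OF eventually_gt_at_top])
  then obtain N where "0 < N" "harm N > C powr p * ((8 * pi) powr r * (2 * pi) ^ (?m + 2)) / A"
    by (auto simp: eventually_at_top_linorder)
  with bound[of N] show False by linarith
qed

end
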